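(* Let $\delta>0$, $0\leq\theta\leq 1$ and $0\leq\nu<1$. Let $f:\mathbb{R}^3\times\mathbb{R}^+\to[0,\infty)$ be a measurable function of $(v,I)$ with $$\int_{\mathbb{R}^3\times\mathbb{R}^+} f\,dv\,dI>0,\qquad \int_{\mathbb{R}^3\times\mathbb{R}^+}\left(1+|v|^2+I^{\frac{2}{\delta}}\right)f(v,I)\,dv\,dI<\infty .$$ Then the remainder term $$R_{\nu,\theta}=\int_{\mathbb{R}^3\times\mathbb{R}^+}\{\mathcal{M}_{\nu,\theta}(f)-f\}\left(\frac{1}{2}(v-U)^{\top}\mathcal{T}_{\nu,\theta}^{-1}(v-U)+\frac{I^{\frac{2}{\delta}}}{T_{\theta}}\right)dv\,dI$$ is non-negative: $R_{\nu,\theta}\geq 0$.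
   Context: Here $\mathbb{R}^+=(0,\infty)$ and $\delta>0$ is a fixed real number (degrees of freedom of non-translational motion). In the underlying kinetic model $f=f(t,x,v,I)$; the time $t$ and position $x$ are fixed parameters in all quantities below and are suppressed. Define $$\rho=\int_{\mathbb{R}^3\times\mathbb{R}^+}f\,dv\,dI,\qquad U=\frac1\rho\int_{\mathbb{R}^3\times\mathbb{R}^+}v f\,dv\,dI\in\mathbb{R}^3,\qquad \Theta=\frac1\rho\int_{\mathbb{R}^3\times\mathbb{R}^+}(v-U)\otimes(v-U)\,f\,dv\,dI\in\mathbb{R}^{3\times3},$$ $$E_{tr}=\int_{\mathbb{R}^3\times\mathbb{R}^+}\tfrac12|v-U|^2f\,dv\,dI,\qquad E_{I,\delta}=\int_{\mathbb{R}^3\times\mathbb{R}^+}I^{\frac2\delta}f\,dv\,dI,\qquad E_\delta=E_{tr}+E_{I,\delta}.$$ The temperatures $T_\delta,T_{tr},T_{I,\delta}$ are defined by $$E_\delta=\frac{3+\delta}{2}\rho T_\delta,\qquad E_{tr}=\frac32\rho T_{tr},\qquad E_{I,\delta}=\frac\delta2\rho T_{I,\delta}.$$ The corrected temperature tensor and relaxation temperature are $$\mathcal{T}_{\nu,\theta}=(1-\theta)\{(1-\nu)T_{tr}\,\mathrm{Id}+\nu\Theta\}+\theta T_\delta\,\mathrm{Id},\qquad T_\theta=(1-\theta)T_{I,\delta}+\theta T_\delta,$$ and the polyatomic Gaussian is $$\mathcal{M}_{\nu,\theta}(f)(v,I)=\frac{\rho\,\Lambda_\delta}{\sqrt{\det(2\pi\mathcal{T}_{\nu,\theta})}\;T_\theta^{\frac\delta2}}\exp\left(-\frac12(v-U)^\top\mathcal{T}_{\nu,\theta}^{-1}(v-U)-\frac{I^{\frac2\delta}}{T_\theta}\right),\qquad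 \Lambda_\delta=\frac{1}{\int_{\mathbb{R}^+}e^{-I^{2/\delta}}dI}.$$ *)

theory Defs
  imports "HOL-Analysis.Analysis"
begin

text \<open>
  Lebesgue measure on the velocity--energy space \<open>\<real>\<^sup>3 \<times> (0,\<infinity>)\<close>. A density \<open>f\<close> is a total function
  on \<open>\<real>\<^sup>3 \<times> \<real>\<close>; every integral below runs over this space, so its values at \<open>I \<le> 0\<close> are irrelevant.
\<close>

abbreviation phase :: "((real^3) \<times> real) measure" where
  "phase \<equiv> lebesgue_on (UNIV \<times> {0<..})"

definition tensor :: "real^3 \<Rightarrow> real^3 \<Rightarrow> real^3^3" where
  "tensor x y = (\<chi> i j. x $ i * y $ j)"

definition mass_density :: "((real^3) \<times> real \<Rightarrow> real) \<Rightarrow> real" where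
  "mass_density f = (\<integral>(v, I). f (v, I) \<partial>phase)"

definition bulk_velocity :: "((real^3) \<times> real \<Rightarrow> real) \<Rightarrow> real^3" where
  "bulk_velocity f = (1 / mass_density f) *\<^sub>R (\<integral>(v, I). f (v, I) *\<^sub>R v \<partial>phase)"

definition stress_tensor :: "((real^3) \<times> real \<Rightarrow> real) \<Rightarrow> real^3^3" where
  "stress_tensor f = (1 / mass_density f) *\<^sub>R
     (\<integral>(v, I). f (v, I) *\<^sub>R tensor (v - bulk_velocity f) (v - bulk_velocity f) \<partial>phase)"

definition E_tr :: "((real^3) \<times> real \<Rightarrow> real) \<Rightarrow> real" where
  "E_tr f = (\<integral>(v, I). 1 / 2 * (norm (v - bulk_velocity f))\<^sup>2 * f (v, I) \<partial>phase)"

definition E_int :: "real \<Rightarrow> ((real^3) \<times> real \<Rightarrow> real) \<Rightarrow> real" where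
  "E_int \<delta> f = (\<integral>(v, I). I powr (2 / \<delta>) * f (v, I) \<partial>phase)"

definition E_total :: "real \<Rightarrow> ((real^3) \<times> real \<Rightarrow> real) \<Rightarrow> real" where
  "E_total \<delta> f = E_tr f + E_int \<delta> f"

text \<open>The temperatures are defined by the relations in \<open>temperature_relations\<close> below.\<close>

definition T_total :: "real \<Rightarrow> ((real^3) \<times> real \<Rightarrow> real) \<Rightarrow> real" where
  "T_total \<delta> f = E_total \<delta> f / ((3 + \<delta>) / 2 * mass_density f)"

definition T_tr :: "((real^3) \<times> real \<Rightarrow> real) \<Rightarrow> real" where
  "T_tr f = E_tr f / (3 / 2 * mass_density f)"

definition T_int :: "real \<Rightarrow> ((real^3) \<times> real \<Rightarrow> real) \<Rightarrow> real" where
  "T_int \<delta> f = E_int \<delta> f / (\<delta> / 2 * mass_density f)"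

lemma temperature_relations:
  assumes "\<delta> > 0" "mass_density f \<noteq> 0"
  shows "E_total \<delta> f = (3 + \<delta>) / 2 * mass_density f * T_total \<delta> f"
    and "E_tr f = 3 / 2 * mass_density f * T_tr f"
    and "E_int \<delta> f = \<delta> / 2 * mass_density f * T_int \<delta> f"
  using assms by (simp_all add: T_total_def T_tr_def T_int_def)

definition temperature_tensor :: "real \<Rightarrow> real \<Rightarrow> real \<Rightarrow> ((real^3) \<times> real \<Rightarrow> real) \<Rightarrow> real^3^3" where
  "temperature_tensor \<delta> \<nu> \<theta> f =
     (1 - \<theta>) *\<^sub>R (((1 - \<nu>) * T_tr f) *\<^sub>R mat 1 + \<nu> *\<^sub>R stress_tensor f)
     + (\<theta> * T_total \<delta> f) *\<^sub>R mat 1"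

definition relaxation_temperature :: "real \<Rightarrow> real \<Rightarrow> ((real^3) \<times> real \<Rightarrow> real) \<Rightarrow> real" where
  "relaxation_temperature \<delta> \<theta> f = (1 - \<theta>) * T_int \<delta> f + \<theta> * T_total \<delta> f"

definition normalizer :: "real \<Rightarrow> real" where
  "normalizer \<delta> = 1 / (\<integral>I. exp (- (I powr (2 / \<delta>))) \<partial>lebesgue_on {0<..})"

definition gaussian_exponent ::
    "real \<Rightarrow> real \<Rightarrow> real \<Rightarrow> ((real^3) \<times> real \<Rightarrow> real) \<Rightarrow> real^3 \<Rightarrow> real \<Rightarrow> real" where
  "gaussian_exponent \<delta> \<nu> \<theta> f v I =
     1 / 2 * ((v - bulk_velocity f) \<bullet>
              (matrix_inv (temperature_tensor \<delta> \<nu> \<theta> f) *v (v - bulk_velocity f)))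
     + I powr (2 / \<delta>) / relaxation_temperature \<delta> \<theta> f"

definition polyatomic_gaussian ::
    "real \<Rightarrow> real \<Rightarrow> real \<Rightarrow> ((real^3) \<times> real \<Rightarrow> real) \<Rightarrow> real^3 \<Rightarrow> real \<Rightarrow> real" where
  "polyatomic_gaussian \<delta> \<nu> \<theta> f v I =
     mass_density f * normalizer \<delta>
     / (sqrt (det ((2 * pi) *\<^sub>R temperature_tensor \<delta> \<nu> \<theta> f))
        * relaxation_temperature \<delta> \<theta> f powr (\<delta> / 2))
     * exp (- gaussian_exponent \<delta> \<nu> \<theta> f v I)"

definition remainder_term :: "real \<Rightarrow> real \<Rightarrow> real \<Rightarrow> ((real^3) \<times> real \<Rightarrow> real) \<Rightarrow> real" where
  "remainder_term \<delta> \<nu> \<theta> f =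
     (\<integral>(v, I). (polyatomic_gaussian \<delta> \<nu> \<theta> f v I - f (v, I)) * gaussian_exponent \<delta> \<nu> \<theta> f v I \<partial>phase)"

end

theory Submission
  imports Defs "HOL-Probability.Distributions"
begin

text \<open>
  Write \<open>g\<close> for the exponent \<open>1/2 (v - U)\<^sup>T T\<^sup>-\<^sup>1 (v - U) + I\<^bsup>2/\<delta>\<^esup> / \<tau>\<close>, where \<open>T\<close> is the corrected temperature
  tensor and \<open>\<tau>\<close> the relaxation temperature, so that the polyatomic Gaussian is a multiple of
  \<open>exp (- g)\<close>. The remainder is the difference of two means of \<open>g\<close>: the mean under the Gaussian,
  which is exactly \<open>\<rho> (3 + \<delta>) / 2\<close> whatever \<open>T\<close> and \<open>\<tau>\<close> are, and the mean under \<open>f\<close>, which is at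
  most that.

  The mean under the Gaussian is equipartition of energy. Evaluated in closed form,
  \<open>\<integral> exp (- s g)\<close> is proportional to \<open>s\<^bsup>-k\<^esup>\<close> with \<open>k = (3 + \<delta>) / 2\<close> (\<open>maxwellian_partition\<close>), and minus the
  derivative at \<open>s = 1\<close> is the integral of \<open>g exp (- g)\<close>
  (\<open>exponent_mean_of_homogeneous_partition\<close>). The constant of proportionality is the normalization
  of the Gaussian, which comes from a linear change of variables that makes the quadratic form of
  \<open>T\<^sup>-\<^sup>1\<close> standard.

  The mean under \<open>f\<close> depends only on second moments and equals
  \<open>\<rho>/2 (tr (T\<^sup>-\<^sup>1 \<Theta>) + \<delta> T\<^sub>I / \<tau>)\<close> (\<open>exponent_moment\<close>). Here \<open>T = a Id + b \<Theta>\<close> with \<open>a > 0\<close> and \<open>b \<ge> 0\<close>. As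
  \<open>\<lambda> \<mapsto> \<lambda> / (a + b \<lambda>)\<close> is concave, replacing each eigenvalue of \<open>\<Theta>\<close> by their average, the
  translational temperature \<open>T\<^sub>t\<^sub>r\<close>, can only increase the trace; the proof without eigenvalues is
  \<open>trace_matrix_inv_mult_le\<close>. This removes \<open>\<nu>\<close> and leaves
  \<open>3 T\<^sub>t\<^sub>r / ((1 - \<theta>) T\<^sub>t\<^sub>r + \<theta> T\<^sub>\<delta>) + \<delta> T\<^sub>I / ((1 - \<theta>) T\<^sub>I + \<theta> T\<^sub>\<delta>)\<close>. Both terms evaluate the concave
  function \<open>x \<mapsto> x / ((1 - \<theta>) x + \<theta> T\<^sub>\<delta>)\<close>, and \<open>T\<^sub>\<delta>\<close> is the average of \<open>T\<^sub>t\<^sub>r\<close> and \<open>T\<^sub>I\<close> with weights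
  \<open>3\<close> and \<open>\<delta>\<close>, so a second use of Jensen's inequality bounds the sum by \<open>3 + \<delta>\<close>
  (\<open>relaxed_ratio_sum_le\<close>).
\<close>

section \<open>Positive definite matrices\<close>

definition pos_def :: "real^'n^'n \<Rightarrow> bool" where
  "pos_def A \<longleftrightarrow> transpose A = A \<and> (\<forall>x. x \<noteq> 0 \<longrightarrow> x \<bullet> (A *v x) > 0)"

lemma symmetric_inner_swap:
  fixes A :: "real^'n^'n"
  assumes "transpose A = A"
  shows "x \<bullet> (A *v y) = y \<bullet> (A *v x)"
  using assms by (metis dot_lmul_matrix inner_commute vector_transpose_matrix)

lemma pos_def_scaleR:
  assumes "pos_def A" "c > 0"
  shows "pos_def (c *\<^sub>R A)"
  using assms
  by (auto simp: pos_def_def transpose_def vec_eq_iff scaleR_matrix_vector_assoc[symmetric])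

text \<open>
  Gram--Schmidt for the inner product \<open>x \<bullet> P y\<close>: as long as there are fewer than \<open>n\<close> vectors, the
  images under \<open>P\<close> of those already chosen do not span the space, and a vector orthogonal to these
  images can be normalized and added.
\<close>
lemma pos_def_orthonormal_family:
  fixes P :: "real^'n^'n"
  assumes P: "pos_def P" and "k \<le> CARD('n)"
  shows "\<exists>b::nat \<Rightarrow> real^'n. \<forall>i<k. \<forall>j<k. b i \<bullet> (P *v b j) = (if i = j then 1 else 0)"
  using \<open>k \<le> CARD('n)\<close>
proof (induction k)
  case 0
  then show ?case by simp
next
  case (Suc k)
  then obtain b :: "nat \<Rightarrow> real^'n"
    where b: "\<And>i j. i < k \<Longrightarrow> j < k \<Longrightarrow> b i \<bullet> (P *v b j) = (if i = j then 1 else 0)"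
    by auto
  define S where "S = (\<lambda>i. P *v b i) ` {..<k}"
  have "dim (span S) \<le> k"
    using dim_le_card'[of S] card_image_le[of "{..<k}" "\<lambda>i. P *v b i"]
    by (simp add: S_def dim_span)
  then have "span S \<noteq> UNIV"
    using Suc.prems by (metis DIM_cart DIM_real dim_UNIV mult.right_neutral not_less_eq_eq order.trans)
  then obtain a where a: "a \<noteq> 0" "\<forall>x\<in>span S. a \<bullet> x = 0"
    using span_not_UNIV_orthogonal by blast
  define q where "q = a \<bullet> (P *v a)"
  have q: "q > 0"
    using P a(1) by (simp add: q_def pos_def_def)
  define c where "c = (1 / sqrt q) *\<^sub>R a"
  have cc: "c \<bullet> (P *v c) = 1"
    using q by (simp add: c_def matrix_vector_mult_scaleR flip: q_def power2_eq_square)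
  have ci: "c \<bullet> (P *v b i) = 0" if "i < k" for i
    using a(2) that by (auto simp: c_def S_def span_base)
  have ic: "b i \<bullet> (P *v c) = 0" if "i < k" for i
    using ci[OF that] P symmetric_inner_swap unfolding pos_def_def by metis
  have "\<forall>i<Suc k. \<forall>j<Suc k. (b(k := c)) i \<bullet> (P *v (b(k := c)) j) = (if i = j then 1 else 0)"
    using b cc ci ic by (auto simp: less_Suc_eq)
  then show ?case by blast
qed

text \<open>
  The columns of \<open>B\<close> are a \<open>P\<close>-orthonormal basis. This factorization replaces the spectral theorem:
  it gives both the sign of the determinant and the substitution that standardizes a Gaussian.
\<close>
lemma pos_def_congruent_to_identity:
  fixes P :: "real^'n^'n"
  assumes "pos_def P"
  obtains B :: "real^'n^'n" where "transpose B ** P ** B = mat 1"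
proof -
  obtain b :: "nat \<Rightarrow> real^'n"
    where b: "\<And>i j. i < CARD('n) \<Longrightarrow> j < CARD('n) \<Longrightarrow>
      b i \<bullet> (P *v b j) = (if i = j then 1 else 0)"
    using pos_def_orthonormal_family[OF assms order_refl] by blast
  obtain h :: "'n \<Rightarrow> nat" where h: "bij_betw h UNIV {..<CARD('n)}"
    using finite_same_card_bij[of "UNIV::'n set" "{..<CARD('n)}"] by auto
  have hl: "h i < CARD('n)" for i
    using bij_betwE[OF h] by auto
  have hi: "h i = h j \<longleftrightarrow> i = j" for i j
    using bij_betw_imp_inj_on[OF h] by (auto dest: injD)
  define B :: "real^'n^'n" where "B = (\<chi> i j. b (h j) $ i)"
  have "(transpose B ** (P ** B)) $ i $ j = b (h i) \<bullet> (P *v b (h j))" for i j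
    by (simp add: B_def transpose_def matrix_matrix_mult_def matrix_vector_mult_def inner_vec_def)
  then have "transpose B ** (P ** B) = mat 1"
    using b hl hi by (simp add: vec_eq_iff mat_def)
  then show ?thesis
    using that by (simp add: matrix_mul_assoc)
qed

lemma pos_def_det:
  fixes P :: "real^'n^'n"
  assumes "pos_def P"
  shows "det P > 0"
proof -
  obtain B :: "real^'n^'n" where "transpose B ** P ** B = mat 1"
    using assms by (rule pos_def_congruent_to_identity)
  then have "det (transpose B ** P ** B) = 1" by simp
  then have "(det B)\<^sup>2 * det P = 1"
    by (simp add: det_mul det_transpose power2_eq_square mult_ac)
  then show ?thesis
    by (metis zero_less_mult_pos zero_less_one zero_less_power2 mult_zero_left power_zero_numeral zero_neq_one)
qed

lemma pos_def_invertible: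
  fixes A :: "real^'n^'n"
  assumes "pos_def A"
  shows "invertible A"
  using pos_def_det[OF assms] by (simp add: invertible_det_nz)

lemma matrix_inv_mult:
  fixes A :: "real^'n^'n"
  assumes "invertible A"
  shows "A ** matrix_inv A = mat 1" and "matrix_inv A ** A = mat 1"
  using someI_ex[OF assms[unfolded invertible_def]] by (auto simp: matrix_inv_def)

lemma pos_def_matrix_inv:
  fixes A :: "real^'n^'n"
  assumes A: "pos_def A"
  shows "pos_def (matrix_inv A)"
proof -
  note inv = matrix_inv_mult[OF pos_def_invertible[OF A]]
  have "transpose (matrix_inv A) ** A = mat 1"
    using A inv by (metis matrix_transpose_mul pos_def_def transpose_mat)
  then have "transpose (matrix_inv A) = matrix_inv A"
    by (metis inv(1) matrix_mul_assoc matrix_mul_lid matrix_mul_rid)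
  moreover have "x \<bullet> (matrix_inv A *v x) > 0" if "x \<noteq> 0" for x
  proof -
    define y where "y = matrix_inv A *v x"
    have x: "x = A *v y"
      by (simp add: y_def matrix_vector_mul_assoc inv)
    then have "y \<noteq> 0" using that by auto
    then have "y \<bullet> (A *v y) > 0" using A by (simp add: pos_def_def)
    then show ?thesis by (simp add: inner_commute y_def[symmetric] flip: x)
  qed
  ultimately show ?thesis by (simp add: pos_def_def)
qed

lemma det_scaleR:
  fixes A :: "real^'n^'n"
  shows "det (c *\<^sub>R A) = c ^ CARD('n) * det A"
proof -
  have "c *\<^sub>R A = (\<chi> i. c *s (A $ i))"
    by (simp add: vec_eq_iff)
  then show ?thesis by (simp add: det_rows_mul[of "\<lambda>_. c" "\<lambda>i. A $ i"])
qed

lemma det_matrix_inv: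
  fixes A :: "real^'n^'n"
  assumes "invertible A"
  shows "det (matrix_inv A) = 1 / det A"
proof -
  have "det A * det (matrix_inv A) = 1"
    using matrix_inv_mult(1)[OF assms] by (metis det_I det_mul)
  moreover from this have "det A \<noteq> 0" by auto
  ultimately show ?thesis by (simp add: eq_divide_eq mult.commute)
qed

lemma trace_scaleR: "trace (c *\<^sub>R A) = c * trace (A :: real^'n^'n)"
  by (simp add: trace_def sum_distrib_left)

lemma matrix_mult_scaleR_right: "A ** (c *\<^sub>R B) = c *\<^sub>R (A ** (B :: real^'n^'m))"
  by (simp add: vec_eq_iff matrix_matrix_mult_def sum_distrib_left mult_ac)

lemma matrix_mult_scaleR_left: "(c *\<^sub>R A) ** B = c *\<^sub>R (A ** (B :: real^'n^'m))"
  by (simp add: vec_eq_iff matrix_matrix_mult_def sum_distrib_left mult_ac)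

text \<open>
  The inequality of arithmetic and harmonic means for the eigenvalues of \<open>A\<close>. Instead of
  diagonalizing, expand \<open>0 \<le> (A\<^sup>-\<^sup>1 e - t e) \<bullet> A (A\<^sup>-\<^sup>1 e - t e)\<close> for each standard basis vector \<open>e\<close>,
  add up, and choose the \<open>t\<close> that makes the resulting lower bound largest.
\<close>
lemma trace_matrix_inv_ge:
  fixes A :: "real^'n^'n"
  assumes A: "pos_def A" and tr: "trace A > 0"
  shows "trace (matrix_inv A) \<ge> (real CARD('n))\<^sup>2 / trace A"
proof -
  let ?P = "matrix_inv A"
  note inv = matrix_inv_mult[OF pos_def_invertible[OF A]]
  \<comment> \<open>The maximizer of \<open>2 t n - t\<^sup>2 tr A\<close>.\<close>
  define t where "t = real CARD('n) / trace A"
  have "2 * t - t\<^sup>2 * A $ i $ i \<le> ?P $ i $ i" for i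
  proof -
    let ?e = "axis i 1 :: real^'n"
    define p q where "p = ?P *v ?e" and "q = A *v ?e"
    have e: "?e \<bullet> (M *v ?e) = M $ i $ i" for M :: "real^'n^'n"
      by (simp add: matrix_vector_mult_basis inner_axis' column_def)
    have Ap: "A *v p = ?e"
      by (simp add: p_def matrix_vector_mul_assoc inv)
    have "p \<bullet> q = ?e \<bullet> (A *v p)"
      using A symmetric_inner_swap unfolding pos_def_def q_def by metis
    then have pq: "p \<bullet> q = 1"
      by (simp add: Ap inner_axis_axis)
    have pe: "p \<bullet> ?e = ?P $ i $ i" and eq: "?e \<bullet> q = A $ i $ i"
      using e[of ?P] e[of A] by (simp_all add: p_def q_def inner_commute)
    have "0 \<le> (p - t *\<^sub>R ?e) \<bullet> (A *v (p - t *\<^sub>R ?e))"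
      using A by (cases "p - t *\<^sub>R ?e = 0") (auto simp: pos_def_def less_imp_le)
    also have "A *v (p - t *\<^sub>R ?e) = ?e - t *\<^sub>R q"
      by (simp add: matrix_vector_mult_diff_distrib matrix_vector_mult_scaleR Ap q_def)
    also have "(p - t *\<^sub>R ?e) \<bullet> (?e - t *\<^sub>R q) = ?P $ i $ i - 2 * t + t\<^sup>2 * A $ i $ i"
      by (simp add: inner_diff_left inner_diff_right pe pq eq inner_axis_axis power2_eq_square algebra_simps)
    finally show ?thesis by simp
  qed
  then have "(\<Sum>i\<in>(UNIV::'n set). 2 * t - t\<^sup>2 * A $ i $ i) \<le> trace ?P"
    unfolding trace_def by (intro sum_mono) auto
  moreover have "(\<Sum>i\<in>(UNIV::'n set). 2 * t - t\<^sup>2 * A $ i $ i) = 2 * t * CARD('n) - t\<^sup>2 * trace A"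
    by (simp add: sum_subtractf trace_def sum_distrib_left)
  moreover have "2 * t * CARD('n) - t\<^sup>2 * trace A = (real CARD('n))\<^sup>2 / trace A"
    using tr by (simp add: t_def field_simps power2_eq_square)
  ultimately show ?thesis by simp
qed

text \<open>
  Jensen's inequality for the concave function \<open>\<lambda> \<mapsto> \<lambda> / (a + b \<lambda>)\<close> on the spectrum of \<open>Q\<close>, with mean
  \<open>t\<close>. With \<open>A = a Id + b Q\<close> one has \<open>b A\<^sup>-\<^sup>1 Q = Id - a A\<^sup>-\<^sup>1\<close>, so for \<open>b > 0\<close> the upper bound
  is the lower bound for the trace of \<open>A\<^sup>-\<^sup>1\<close>; for \<open>b = 0\<close> there is equality.
\<close>
lemma trace_matrix_inv_mult_le:
  fixes Q :: "real^'n^'n" and a b t :: real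
  assumes A: "pos_def (a *\<^sub>R mat 1 + b *\<^sub>R Q)" and "a > 0" "b \<ge> 0"
    and tr: "trace Q = CARD('n) * t" and "t \<ge> 0"
  shows "trace (matrix_inv (a *\<^sub>R mat 1 + b *\<^sub>R Q) ** Q) \<le> CARD('n) * t / (a + b * t)"
proof -
  let ?A = "a *\<^sub>R mat 1 + b *\<^sub>R Q" and ?n = "real CARD('n)"
  let ?P = "matrix_inv ?A"
  have "?P ** ?A = mat 1"
    by (rule matrix_inv_mult(2)[OF pos_def_invertible[OF A]])
  then have eq: "a *\<^sub>R ?P + b *\<^sub>R (?P ** Q) = mat 1"
    by (simp add: matrix_add_ldistrib matrix_mult_scaleR_right)
  show ?thesis
  proof (cases "b = 0")
    case True
    then have "a *\<^sub>R ?P = mat 1" using eq by simp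
    then have "?P = (1 / a) *\<^sub>R mat 1"
      using \<open>a > 0\<close> by (metis divide_self_if divide_inverse_commute less_numeral_extra(3) scaleR_one scaleR_scaleR)
    then have "?P ** Q = (1 / a) *\<^sub>R Q"
      by (simp add: matrix_mult_scaleR_left)
    then have "trace (?P ** Q) = ?n * t / a" by (simp only: trace_scaleR tr) simp
    then show ?thesis using True by simp
  next
    case False
    then have b: "b > 0" using \<open>b \<ge> 0\<close> by simp
    have pos: "a + b * t > 0" using \<open>a > 0\<close> b \<open>t \<ge> 0\<close> by (simp add: add_pos_nonneg)
    have trA: "trace ?A = ?n * (a + b * t)"
      by (simp add: trace_add trace_scaleR trace_I tr algebra_simps)
    have "?n / (a + b * t) \<le> trace ?P"
      using trace_matrix_inv_ge[OF A] pos by (simp add: trA power2_eq_square)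
    moreover have "a * trace ?P + b * trace (?P ** Q) = ?n"
      using arg_cong[OF eq, of trace] by (simp add: trace_add trace_scaleR trace_I)
    ultimately have "b * trace (?P ** Q) \<le> ?n - a * (?n / (a + b * t))"
      using \<open>a > 0\<close> by (smt (verit) mult_left_mono)
    also have "\<dots> = b * (?n * t / (a + b * t))"
      using pos by (simp add: field_simps)
    finally show ?thesis using b by (rule mult_left_le_imp_le)
  qed
qed

section \<open>Gaussian and internal-energy integrals\<close>

lemma std_gaussian_integral:
  "has_bochner_integral lborel (\<lambda>x::real^'n. exp (- (x \<bullet> x) / 2)) (sqrt (2 * pi) ^ CARD('n))"
proof (rule has_bochner_integral_nn_integral)
  have 1: "(\<integral>\<^sup>+x. ennreal (exp (- x\<^sup>2 / 2)) \<partial>lborel) = ennreal (sqrt (2 * pi))"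
  proof -
    have "(\<integral>\<^sup>+x. ennreal (normal_density 0 1 x) \<partial>lborel) = 1"
      using nn_integral_eq_integral[OF integrable_normal_density[of 1 0]] by (simp add: integral_normal_density)
    then have "ennreal (sqrt (2*pi)) * (\<integral>\<^sup>+x. ennreal (normal_density 0 1 x) \<partial>lborel) = ennreal (sqrt (2*pi))"
      by simp
    then show ?thesis
      by (subst (asm) nn_integral_cmult[symmetric])
         (auto simp: normal_density_def simp flip: ennreal_mult)
  qed
  have "(\<integral>\<^sup>+x. ennreal (exp (- (x \<bullet> x) / 2)) \<partial>(lborel::(real^'n) measure))
      = (\<integral>\<^sup>+x. (\<Prod>b\<in>Basis. ennreal (exp (- (x \<bullet> b)\<^sup>2 / 2))) \<partial>(lborel::(real^'n) measure))"
  proof (rule nn_integral_cong)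
    fix x :: "real^'n"
    have "- (x \<bullet> x) / 2 = (\<Sum>b\<in>Basis. - (x \<bullet> b)\<^sup>2 / 2)"
      by (subst euclidean_inner) (simp add: power2_eq_square sum_negf sum_divide_distrib)
    then show "ennreal (exp (- (x \<bullet> x) / 2)) = (\<Prod>b\<in>Basis. ennreal (exp (- (x \<bullet> b)\<^sup>2 / 2)))"
      by (simp add: prod_ennreal exp_sum)
  qed
  also have "\<dots> = (\<Prod>b\<in>(Basis::(real^'n) set). (\<integral>\<^sup>+x. ennreal (exp (- x\<^sup>2 / 2)) \<partial>lborel))"
    by (rule nn_integral_lborel_prod) auto
  also have "\<dots> = ennreal (sqrt (2 * pi) ^ CARD('n))"
    unfolding 1 by (simp add: ennreal_power)
  finally show "(\<integral>\<^sup>+x. ennreal (exp (- (x \<bullet> x) / 2)) \<partial>(lborel::(real^'n) measure))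
      = ennreal (sqrt (2 * pi) ^ CARD('n))" .
qed auto

lemma continuous_on_quadratic_form:
  fixes M :: "real^'n^'n"
  shows "continuous_on S (\<lambda>x. x \<bullet> (M *v x))"
  by (intro continuous_intros linear_continuous_on) (auto simp: linear_linear)

text \<open>
  Substitute \<open>x = B y\<close> with \<open>B\<^sup>T P B = Id\<close>: the quadratic form becomes \<open>y \<bullet> y\<close> and the Jacobian
  \<open>\<bar>det B\<bar>\<close> is \<open>1 / sqrt (det P)\<close>.
\<close>
lemma gaussian_integral:
  fixes P :: "real^'n::{finite,wellorder}^'n::_"
  assumes P: "pos_def P"
  shows "has_bochner_integral lborel (\<lambda>x. exp (- (x \<bullet> (P *v x)) / 2))
           (sqrt ((2 * pi) ^ CARD('n) / det P))"
proof -
  obtain B :: "real^'n::_^'n::_" where B: "transpose B ** P ** B = mat 1"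
    using P by (rule pos_def_congruent_to_identity)
  then have "det (transpose B ** P ** B) = 1" by simp
  then have d: "(det B)\<^sup>2 * det P = 1"
    by (simp add: det_mul det_transpose power2_eq_square mult_ac)
  then have "det B \<noteq> 0" by auto
  then have surj: "range ((*v) B) = UNIV"
    by (metis invertible_det_nz invertible_right_inverse matrix_right_invertible_surjective)
  have detB: "\<bar>det B\<bar> = sqrt (1 / det P)"
    using d pos_def_det[OF P] by (intro real_sqrt_unique[symmetric]) (auto simp: field_simps)
  have q: "(B *v y) \<bullet> (P *v (B *v y)) = y \<bullet> y" for y
  proof -
    have "(B *v y) \<bullet> (P *v (B *v y)) = y \<bullet> ((transpose B ** P ** B) *v y)"
      by (metis dot_lmul_matrix inner_commute matrix_vector_mul_assoc transpose_matrix_vector)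
    then show ?thesis by (simp add: B)
  qed
  define g where "g = (\<lambda>x. exp (- (x \<bullet> (P *v x)) / 2))"
  have cont: "continuous_on UNIV g"
    unfolding g_def by (intro continuous_intros continuous_on_quadratic_form) simp
  then have meas[measurable]: "g \<in> borel_measurable borel"
    by (rule borel_measurable_continuous_onI)
  \<comment> \<open>The linear change of variables is stated for integrands with values in a vector type, so the
     scalar integrand passes through \<open>real^1\<close>.\<close>
  define G :: "real^'n::_ \<Rightarrow> real^1" where "G = (\<lambda>x. vec (g x))"
  have vec: "bounded_linear (vec :: real \<Rightarrow> real^1)"
    by (intro linear_linear[THEN iffD2] linear_vec)
  have GB: "G \<circ> (*v) B = (\<lambda>y. vec (exp (- (y \<bullet> y) / 2)))"
    by (auto simp: G_def g_def q)
  have std: "integrable lborel (\<lambda>x::real^'n::_. exp (- (x \<bullet> x) / 2))"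
    "integral\<^sup>L lborel (\<lambda>x::real^'n::_. exp (- (x \<bullet> x) / 2)) = sqrt (2 * pi) ^ CARD('n)"
    using std_gaussian_integral by (auto simp: has_bochner_integral_iff)
  have iGB: "integrable lborel (G \<circ> (*v) B)"
    unfolding GB by (rule integrable_bounded_linear[OF vec std(1)])
  then have "integrable lebesgue (G \<circ> (*v) B)"
    by (subst integrable_completion) auto
  then have aGB: "(G \<circ> (*v) B) absolutely_integrable_on UNIV"
    by (simp add: set_integrable_def o_def)
  have lin: "linear ((*v) B)" by simp
  have mB: "matrix ((*v) B) = B" by simp
  have "G absolutely_integrable_on (range ((*v) B))"
    using absolutely_integrable_on_linear_image[OF lin] aGB by blast
  then have aG: "G absolutely_integrable_on UNIV" using surj by simp
  have comp: "bounded_linear (\<lambda>x::real^1. x $ 1)" by (rule bounded_linear_vec_nth)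
  have "integrable lebesgue G" using aG by (simp add: set_integrable_def)
  from integrable_bounded_linear[OF comp this] have "integrable lebesgue g"
    by (simp add: G_def)
  then have ig: "integrable lborel g" by (subst (asm) integrable_completion) auto
  have iG: "integrable lborel G" unfolding G_def by (rule integrable_bounded_linear[OF vec ig])
  have "integral UNIV G = \<bar>det B\<bar> *\<^sub>R integral UNIV (G \<circ> (*v) B)"
    using integral_change_of_variables_linear[OF lin, where f=G and S=UNIV] aGB unfolding surj mB by blast
  then have "integral\<^sup>L lborel G = \<bar>det B\<bar> *\<^sub>R integral\<^sup>L lborel (G \<circ> (*v) B)"
    using integral_lborel[OF iG] integral_lborel[OF iGB] by argo
  then have "(vec (integral\<^sup>L lborel g) :: real^1) = \<bar>det B\<bar> *\<^sub>R vec (sqrt (2 * pi) ^ CARD('n))"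
    unfolding GB using integral_bounded_linear[OF vec ig] integral_bounded_linear[OF vec std(1)] std(2)
    by (simp add: G_def)
  then have "integral\<^sup>L lborel g = \<bar>det B\<bar> * sqrt (2 * pi) ^ CARD('n)"
    by (simp add: vec_eq_iff)
  also have "\<dots> = sqrt ((2 * pi) ^ CARD('n) / det P)"
    by (simp add: detB real_sqrt_divide real_sqrt_mult real_sqrt_power power_mult_distrib)
  finally show ?thesis
    using ig by (simp add: has_bochner_integral_iff g_def)
qed

lemma has_bochner_integral_lborel_translate:
  fixes F :: "'a::euclidean_space \<Rightarrow> real"
  assumes "has_bochner_integral lborel F a"
  shows "has_bochner_integral lborel (\<lambda>x. F (x - c)) a"
proof -
  have [measurable]: "F \<in> borel_measurable borel"
    using assms by (auto simp: has_bochner_integral_iff dest!: borel_measurable_integrable)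
  have "has_bochner_integral (distr lborel borel ((+) (- c))) F a"
    using assms by (simp add: lborel_distr_plus)
  then have "has_bochner_integral lborel (\<lambda>x. F (- c + x)) a"
    by (subst (asm) has_bochner_integral_iff, subst (asm) integrable_distr_eq, simp, simp,
        subst (asm) integral_distr, simp, simp) (simp add: has_bochner_integral_iff)
  then show ?thesis by simp
qed

text \<open>
  The tail beats every power: \<open>exp (- u) \<le> m! u\<^bsup>-m\<^esup>\<close> for \<open>u = x\<^bsup>p\<^esup>\<close>, and this is at most \<open>m! x\<^bsup>-2\<^esup>\<close> for
  \<open>x \<ge> 1\<close> once \<open>m p \<ge> 2\<close>.
\<close>
lemma integrable_exp_neg_powr:
  fixes p :: real
  assumes "p > 0"
  shows "integrable lborel (\<lambda>x. indicator {0<..} x * exp (- (x powr p)))"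
proof -
  obtain m :: nat where m: "real m * p \<ge> 2"
    using real_arch_simple[of "2 / p"] assms by (auto simp: field_simps)
  have "(\<lambda>x::real. x powr (-2)) absolutely_integrable_on {1..}"
    by (rule nonnegative_absolutely_integrable_1) (use has_integral_powr_to_inf[of "-2" 1] in \<open>auto simp: integrable_on_def\<close>)
  then have "integrable lborel (\<lambda>x::real. indicator {1..} x * x powr (-2))"
    unfolding set_integrable_def by (subst (asm) integrable_completion) auto
  moreover have "integrable lborel (\<lambda>x::real. indicator {0..1} x :: real)"
    by (simp add: integrable_indicator_iff)
  ultimately have "integrable lborel
      (\<lambda>x::real. indicator {0..1} x + fact m * (indicator {1..} x * x powr (-2)) :: real)"
    by (intro Bochner_Integration.integrable_add integrable_mult_right)
  then show ?thesis
  proof (rule Bochner_Integration.integrable_bound)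
    have "indicator {0<..} x * exp (- (x powr p))
        \<le> indicator {0..1} x + fact m * (indicator {1..} x * x powr (-2))" for x :: real
    proof (cases "x \<ge> 1")
      case True
      define u where "u = x powr p"
      have u: "u > 0" using True by (simp add: u_def)
      have "x powr 2 \<le> x powr (real m * p)" using True m by (intro powr_mono) auto
      also have "\<dots> = u ^ m"
        using u True by (simp add: u_def powr_powr mult.commute flip: powr_realpow)
      finally have "x powr 2 \<le> u ^ m" .
      also have "u ^ m / fact m \<le> exp u"
        using u sum_le_suminf[of "\<lambda>n. u ^ n /\<^sub>R fact n" "{m}"]
          summable_exp_generic[of u] by (simp add: exp_def divide_inverse mult.commute)
      then have "u ^ m \<le> fact m * exp u" by (simp add: field_simps)
      finally have "x powr 2 \<le> fact m * exp u" .
      then have "exp (- u) \<le> fact m * x powr (-2)"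
        using True by (simp add: exp_minus powr_minus field_simps)
      then have "indicator {0<..} x * exp (- u) \<le> fact m * (indicator {1..} x * x powr (-2))"
        using True by simp
      then show ?thesis unfolding u_def by (rule add_increasing[rotated]) simp
    qed (auto simp: indicator_def)
    then show "AE x in lborel. norm (indicator {0<..} x * exp (- (x powr p)))
        \<le> norm (indicator {0..1} x + fact m * (indicator {1..} x * x powr (-2)))"
      by (intro always_eventually allI) (simp add: abs_mult)
  qed simp
qed

lemma internal_energy_normalizer:
  assumes "\<delta> > 0"
  shows "normalizer \<delta> > 0"
    and "has_bochner_integral lborel (\<lambda>x. indicator {0<..} x * exp (- (x powr (2 / \<delta>)))) (1 / normalizer \<delta>)"
proof -
  let ?g = "\<lambda>x. indicator {0<..} x * exp (- (x powr (2 / \<delta>))) :: real"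
  have i: "integrable lborel ?g"
    using assms by (intro integrable_exp_neg_powr) simp
  have eq: "(\<integral>x. exp (- (x powr (2 / \<delta>))) \<partial>lebesgue_on {0<..}) = integral\<^sup>L lborel ?g"
    by (subst integral_restrict_space) (simp_all add: integral_completion)
  have "0 < (LBINT x::real. indicator {0..1} x * exp (-1::real))"
    by (simp add: measure_lborel_Icc)
  also have "\<dots> \<le> integral\<^sup>L lborel ?g"
  proof (rule integral_mono_AE)
    show "AE x in lborel. indicator {0..1} x * exp (-1) \<le> ?g x"
      using AE_lborel_singleton[of 0]
    proof eventually_elim
      case (elim x)
      have "x powr (2 / \<delta>) \<le> 1 powr (2 / \<delta>)" if "0 < x" "x \<le> 1"
        using that assms by (intro powr_mono2) auto
      then show ?case using elim by (auto simp: indicator_def)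
    qed
  qed (use i in \<open>auto intro!: integrable_mult_left simp: integrable_indicator_iff\<close>)
  finally show "normalizer \<delta> > 0"
    by (simp add: normalizer_def eq)
  show "has_bochner_integral lborel ?g (1 / normalizer \<delta>)"
    using i by (simp add: has_bochner_integral_iff normalizer_def eq)
qed

text \<open>The substitution \<open>x = s\<^bsup>-\<delta>/2\<^esup> y\<close> turns \<open>s x\<^bsup>2/\<delta>\<^esup>\<close> into \<open>y\<^bsup>2/\<delta>\<^esup>\<close>.\<close>
lemma internal_energy_integral:
  assumes "\<delta> > 0" "s > 0"
  shows "has_bochner_integral lborel (\<lambda>x. indicator {0<..} x * exp (- (s * x powr (2 / \<delta>))))
           (s powr (- \<delta> / 2) / normalizer \<delta>)"
proof -
  define c where "c = s powr (- \<delta> / 2)"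
  have c: "c > 0" using assms by (simp add: c_def)
  have "c powr (2 / \<delta>) = s powr ((- \<delta> / 2) * (2 / \<delta>))"
    by (simp only: c_def powr_powr)
  also have "\<dots> = 1 / s"
    using assms by (simp add: powr_minus_divide)
  finally have cp: "c powr (2 / \<delta>) = 1 / s" .
  have "(s * (c * x) powr (2 / \<delta>)) = x powr (2 / \<delta>)" if "x > 0" for x
    using that c assms by (simp add: powr_mult cp)
  then have "(\<lambda>x. indicator {0<..} (0 + c * x) * exp (- (s * (0 + c * x) powr (2 / \<delta>))))
      = (\<lambda>x. indicator {0<..} x * exp (- (x powr (2 / \<delta>))))"
    using c by (auto simp: indicator_def zero_less_mult_iff)
  then show ?thesis
    using lborel_has_bochner_integral_real_affine_iff[of c
        "\<lambda>x. indicator {0<..} x * exp (- (s * x powr (2 / \<delta>)))" "c / normalizer \<delta>" 0]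
      internal_energy_normalizer(2)[OF assms(1)] c
    by (simp add: c_def)
qed

section \<open>Integration over the velocity--energy space\<close>

lemma half_space_lebesgue: "(UNIV \<times> {0<..}) \<inter> space lebesgue \<in> sets (lebesgue :: ((real^3) \<times> real) measure)"
  by (auto intro!: lebesgue_openin[of UNIV] simp: open_Times)

lemma borel_measurable_phase:
  assumes "h \<in> borel_measurable borel"
  shows "h \<in> borel_measurable phase"
  using assms by (intro measurable_restrict_space1 measurable_completion) simp

lemma borel_measurable_snd_powr: "(\<lambda>z::(real^3) \<times> real. snd z powr p) \<in> borel_measurable borel"
  unfolding borel_prod[symmetric] by measurable

text \<open>
  The velocity spread of a density of positive mass is positive because a single velocity carries no
  Lebesgue measure.
\<close>
lemma AE_phase_velocity_neq: "AE z in phase. fst z \<noteq> U"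
proof -
  \<comment> \<open>The line \<open>v = U\<close> lies in the hyperplane where the first velocity components agree.\<close>
  have "negligible {z :: (real^3) \<times> real. (axis 1 1, 0) \<bullet> z = U $ 1}"
    by (rule negligible_hyperplane) (simp add: axis_eq_0_iff zero_prod_def)
  then have "AE z in (lebesgue :: ((real^3) \<times> real) measure). (axis 1 1, 0) \<bullet> z \<noteq> U $ 1"
    unfolding negligible_iff_null_sets by (auto dest: AE_not_in)
  then have "AE z in (lebesgue :: ((real^3) \<times> real) measure). fst z \<noteq> U"
    by eventually_elim (auto simp: inner_prod_def inner_axis')
  then show ?thesis
    by (subst AE_restrict_space_iff[OF half_space_lebesgue]) auto
qed

lemma has_bochner_integral_phase_product:
  fixes F :: "real^3 \<Rightarrow> real" and H :: "real \<Rightarrow> real"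
  assumes F: "has_bochner_integral lborel F a" "\<And>v. 0 \<le> F v"
    and H: "has_bochner_integral lborel (\<lambda>x. indicator {0<..} x * H x) b" "\<And>x. 0 \<le> H x"
  shows "has_bochner_integral phase (\<lambda>(v, I). F v * H I) (a * b)"
proof -
  define H' where "H' = (\<lambda>x. indicator {0<..} x * H x)"
  have [measurable]: "F \<in> borel_measurable borel" "H' \<in> borel_measurable borel"
    using F(1) H(1) by (auto simp: has_bochner_integral_iff H'_def dest!: borel_measurable_integrable)
  have H'0: "0 \<le> H' x" for x using H(2) by (simp add: H'_def)
  have a: "(\<integral>\<^sup>+v. ennreal (F v) \<partial>lborel) = ennreal a" "0 \<le> a"
    using F nn_integral_eq_integral[of lborel F] by (auto simp: has_bochner_integral_iff)
  have b: "(\<integral>\<^sup>+x. ennreal (H' x) \<partial>lborel) = ennreal b" "0 \<le> b"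
    using H(1) H'0 nn_integral_eq_integral[of lborel H'] by (auto simp: has_bochner_integral_iff simp flip: H'_def)
  have "(\<integral>\<^sup>+z. ennreal (F (fst z) * H' (snd z)) \<partial>(lborel \<Otimes>\<^sub>M lborel))
      = (\<integral>\<^sup>+v. \<integral>\<^sup>+x. ennreal (F v) * ennreal (H' x) \<partial>lborel \<partial>lborel)"
    by (subst lborel.nn_integral_fst[symmetric]) (auto simp: ennreal_mult F(2) H'0)
  also have "\<dots> = ennreal (a * b)"
    by (simp add: nn_integral_cmult nn_integral_multc a b ennreal_mult)
  finally have "has_bochner_integral lborel (\<lambda>z. F (fst z) * H' (snd z)) (a * b)"
    using a b F(2) H'0
    by (intro has_bochner_integral_nn_integral) (auto simp: lborel_prod borel_prod[symmetric])
  then have "has_bochner_integral lebesgue (\<lambda>z. F (fst z) * H' (snd z)) (a * b)"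
    by (auto simp: has_bochner_integral_iff integrable_completion integral_completion)
  moreover have "(\<lambda>z. F (fst z) * H' (snd z))
      = (\<lambda>z. indicator (UNIV \<times> {0<..}) z *\<^sub>R (case z of (v, I) \<Rightarrow> F v * H I))"
    by (auto simp: H'_def indicator_def)
  ultimately show ?thesis
    by (subst has_bochner_integral_restrict_space[OF half_space_lebesgue]) simp
qed

text \<open>
  The partition function of the exponent at inverse temperature \<open>s\<close>. Each of the three velocity
  directions contributes a factor \<open>s\<^bsup>-1/2\<^esup>\<close> and the internal energy a factor \<open>s\<^bsup>-\<delta>/2\<^esup>\<close>.
\<close>
lemma maxwellian_partition:
  fixes A :: "real^3^3" and U :: "real^3"
  assumes A: "pos_def A" and "\<delta> > 0" "\<tau> > 0" and s: "s > 0"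
  shows "has_bochner_integral phase
     (\<lambda>(v, I). exp (- (s * (1 / 2 * ((v - U) \<bullet> (matrix_inv A *v (v - U))) + I powr (2 / \<delta>) / \<tau>))))
     (s powr (- ((3 + \<delta>) / 2)) * (sqrt (det ((2 * pi) *\<^sub>R A)) * \<tau> powr (\<delta> / 2) / normalizer \<delta>))"
proof -
  let ?P = "s *\<^sub>R matrix_inv A"
  have P: "pos_def ?P"
    by (intro pos_def_scaleR pos_def_matrix_inv A s)
  have "has_bochner_integral lborel (\<lambda>v. exp (- ((v - U) \<bullet> (?P *v (v - U))) / 2))
      (sqrt ((2 * pi) ^ CARD(3) / det ?P))"
    using has_bochner_integral_lborel_translate[OF gaussian_integral[OF P]] .
  moreover have "sqrt ((2 * pi) ^ CARD(3) / det ?P) = s powr (- 3 / 2) * sqrt (det ((2 * pi) *\<^sub>R A))"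
  proof -
    have "s powr (- 3 / 2) = sqrt (1 / s ^ 3)"
    proof -
      have "sqrt (1 / s ^ 3) = (s powr (- 3)) powr (1 / 2)"
        using s by (simp add: powr_half_sqrt powr_minus_divide)
      also have "\<dots> = s powr (- 3 / 2)" by (simp only: powr_powr) simp
      finally show ?thesis by simp
    qed
    then show ?thesis
      by (simp add: det_scaleR det_matrix_inv pos_def_invertible A flip: real_sqrt_mult)
  qed
  ultimately have F: "has_bochner_integral lborel (\<lambda>v. exp (- ((v - U) \<bullet> (?P *v (v - U))) / 2))
      (s powr (- 3 / 2) * sqrt (det ((2 * pi) *\<^sub>R A)))"
    by simp
  have H: "has_bochner_integral lborel (\<lambda>x. indicator {0<..} x * exp (- (s / \<tau> * x powr (2 / \<delta>))))
           ((s / \<tau>) powr (- \<delta> / 2) / normalizer \<delta>)"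
    using assms by (intro internal_energy_integral) auto
  have "has_bochner_integral phase
     (\<lambda>(v, I). exp (- ((v - U) \<bullet> (?P *v (v - U))) / 2) * exp (- (s / \<tau> * I powr (2 / \<delta>))))
     (s powr (- 3 / 2) * sqrt (det ((2 * pi) *\<^sub>R A)) * ((s / \<tau>) powr (- \<delta> / 2) / normalizer \<delta>))"
    by (rule has_bochner_integral_phase_product[OF F _ H]) auto
  moreover have "(\<lambda>(v, I). exp (- ((v - U) \<bullet> (?P *v (v - U))) / 2) * exp (- (s / \<tau> * I powr (2 / \<delta>))))
     = (\<lambda>(v, I). exp (- (s * (1 / 2 * ((v - U) \<bullet> (matrix_inv A *v (v - U))) + I powr (2 / \<delta>) / \<tau>))))"
  proof (intro ext, clarify)
    fix v :: "real^3" and I :: real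
    let ?q = "(v - U) \<bullet> (matrix_inv A *v (v - U))"
    have "- ((v - U) \<bullet> (?P *v (v - U))) / 2 + - (s / \<tau> * I powr (2 / \<delta>))
        = - (s * (1 / 2 * ?q + I powr (2 / \<delta>) / \<tau>))"
      unfolding scaleR_matrix_vector_assoc[symmetric] inner_scaleR_right by argo
    then show "exp (- ((v - U) \<bullet> (?P *v (v - U))) / 2) * exp (- (s / \<tau> * I powr (2 / \<delta>)))
        = exp (- (s * (1 / 2 * ?q + I powr (2 / \<delta>) / \<tau>)))"
      by (simp only: exp_add[symmetric])
  qed
  moreover have "s powr (- 3 / 2) * sqrt (det ((2 * pi) *\<^sub>R A)) * ((s / \<tau>) powr (- \<delta> / 2) / normalizer \<delta>)
     = s powr (- ((3 + \<delta>) / 2)) * (sqrt (det ((2 * pi) *\<^sub>R A)) * \<tau> powr (\<delta> / 2) / normalizer \<delta>)"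
  proof -
    have "(s / \<tau>) powr (- \<delta> / 2) = s powr (- \<delta> / 2) * \<tau> powr (\<delta> / 2)"
      using s \<open>\<tau> > 0\<close> by (simp add: powr_divide powr_minus divide_simps)
    moreover have "s powr (- 3 / 2) * s powr (- \<delta> / 2) = s powr (- ((3 + \<delta>) / 2))"
      by (simp add: add_divide_distrib flip: powr_add)
    ultimately show ?thesis by (simp add: mult_ac)
  qed
  ultimately show ?thesis by metis
qed

section \<open>Mean exponent of a homogeneous Gibbs weight\<close>

text \<open>
  This is \<open>\<integral> g exp (- g) = - d/ds \<integral> exp (- s g)\<close> at \<open>s = 1\<close>, proved without differentiating under the
  integral. With \<open>J\<close> the left-hand side, \<open>1 + x \<le> exp x\<close> gives
  \<open>exp (- g) + (1 - s) g exp (- g) \<le> exp (- s g)\<close>; after integration it says that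
  \<open>s \<mapsto> s\<^bsup>-k\<^esup> Z + s J\<close> has a minimum at \<open>s = 1\<close>, where its derivative \<open>- k Z + J\<close> must vanish.
\<close>
lemma exponent_mean_of_homogeneous_partition:
  fixes g :: "'a \<Rightarrow> real"
  assumes g[measurable]: "g \<in> borel_measurable M" and nonneg: "\<And>x. x \<in> space M \<Longrightarrow> 0 \<le> g x"
    and Z: "\<And>s. s > 0 \<Longrightarrow> has_bochner_integral M (\<lambda>x. exp (- (s * g x))) (s powr (- k) * Z)"
  shows "has_bochner_integral M (\<lambda>x. g x * exp (- g x)) (k * Z)"
proof -
  have int: "integrable M (\<lambda>x. exp (- (s * g x)))"
    and eq: "(\<integral>x. exp (- (s * g x)) \<partial>M) = s powr (- k) * Z" if "s > 0" for s
    using Z[OF that] by (auto simp: has_bochner_integral_iff)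
  have iJ: "integrable M (\<lambda>x. g x * exp (- g x))"
  proof (rule Bochner_Integration.integrable_bound)
    show "integrable M (\<lambda>x. 2 * exp (- (1 / 2 * g x)))"
      by (intro integrable_mult_right int) simp
    show "AE x in M. norm (g x * exp (- g x)) \<le> norm (2 * exp (- (1 / 2 * g x)))"
    proof (rule AE_I2)
      fix x assume x: "x \<in> space M"
      have "g x / 2 \<le> exp (g x / 2)" using exp_ge_add_one_self[of "g x / 2"] by linarith
      then have "g x * exp (- g x) \<le> 2 * exp (g x / 2) * exp (- g x)"
        by (intro mult_right_mono) auto
      also have "\<dots> = 2 * exp (- (1 / 2 * g x))"
        by (simp flip: exp_add)
      finally show "norm (g x * exp (- g x)) \<le> norm (2 * exp (- (1 / 2 * g x)))"
        using nonneg[OF x] by (simp add: abs_mult)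
    qed
  qed simp
  define J where "J = (\<integral>x. g x * exp (- g x) \<partial>M)"
  have le: "1 powr (- k) * Z + 1 * J \<le> s powr (- k) * Z + s * J" if s: "s > 0" for s
  proof -
    have "(\<integral>x. exp (- (1 * g x)) + (1 - s) * (g x * exp (- g x)) \<partial>M) \<le> (\<integral>x. exp (- (s * g x)) \<partial>M)"
    proof (rule integral_mono)
      fix x
      have "exp (- g x) * (1 + (1 - s) * g x) \<le> exp (- g x) * exp ((1 - s) * g x)"
        by (intro mult_left_mono exp_ge_add_one_self) auto
      then show "exp (- (1 * g x)) + (1 - s) * (g x * exp (- g x)) \<le> exp (- (s * g x))"
        by (simp add: algebra_simps flip: exp_add)
    qed (use int[of 1] int[OF s] iJ in auto)
    also have "(\<integral>x. exp (- (1 * g x)) + (1 - s) * (g x * exp (- g x)) \<partial>M) = 1 powr (- k) * Z + (1 - s) * J"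
      using int[of 1] eq[of 1] iJ by (simp add: J_def)
    finally show ?thesis using eq[OF s] by (simp add: algebra_simps)
  qed
  have "((\<lambda>s. s powr (- k) * Z + s * J) has_real_derivative (- k * Z + J)) (at 1)"
    by (auto intro!: derivative_eq_intros)
  then have "- k * Z + J = 0"
    by (rule DERIV_local_min[of _ _ _ 1]) (use le in auto)
  then show ?thesis
    using iJ by (simp add: has_bochner_integral_iff J_def)
qed

section \<open>Relaxed temperature ratios\<close>

text \<open>
  The right-hand side is the tangent at \<open>x = z\<close> of the concave function on the left. After clearing
  denominators the gap is \<open>\<theta> (1 - \<theta>) (x - z)\<^sup>2\<close>.
\<close>
lemma relaxed_ratio_le:
  fixes x z \<theta> :: real
  assumes "x > 0" "z > 0" "0 \<le> \<theta>" "\<theta> \<le> 1"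
  shows "x / ((1 - \<theta>) * x + \<theta> * z) \<le> 1 + \<theta> * (x - z) / z"
proof -
  have pos: "(1 - \<theta>) * x + \<theta> * z > 0"
    using assms by (cases "\<theta> = 0") (auto intro!: add_nonneg_pos)
  have "x * z + \<theta> * (1 - \<theta>) * (x - z)\<^sup>2 = (z + \<theta> * (x - z)) * ((1 - \<theta>) * x + \<theta> * z)"
    by (simp add: power2_eq_square algebra_simps)
  moreover have "0 \<le> \<theta> * (1 - \<theta>) * (x - z)\<^sup>2" using assms by simp
  ultimately have "x * z \<le> (z + \<theta> * (x - z)) * ((1 - \<theta>) * x + \<theta> * z)" by linarith
  then have "x / ((1 - \<theta>) * x + \<theta> * z) \<le> (z + \<theta> * (x - z)) / z"
    using pos assms by (simp add: divide_le_eq pos_le_divide_eq mult.commute)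
  also have "\<dots> = 1 + \<theta> * (x - z) / z" using assms by (simp add: add_divide_distrib)
  finally show ?thesis .
qed

text \<open>
  Add the two tangent bounds with weights \<open>m\<close> and \<open>n\<close>: the linear terms cancel because \<open>z\<close> is the
  weighted mean.
\<close>
lemma relaxed_ratio_sum_le:
  fixes x y m n \<theta> :: real
  assumes "x > 0" "y > 0" "m > 0" "n > 0" "0 \<le> \<theta>" "\<theta> \<le> 1"
  defines "z \<equiv> (m * x + n * y) / (m + n)"
  shows "m * x / ((1 - \<theta>) * x + \<theta> * z) + n * y / ((1 - \<theta>) * y + \<theta> * z) \<le> m + n"
proof -
  have z: "z > 0" using assms by (simp add: z_def add_pos_pos)
  have "m * (x / ((1 - \<theta>) * x + \<theta> * z)) + n * (y / ((1 - \<theta>) * y + \<theta> * z))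
      \<le> m * (1 + \<theta> * (x - z) / z) + n * (1 + \<theta> * (y - z) / z)"
    using assms z by (intro add_mono mult_left_mono relaxed_ratio_le) auto
  also have "\<dots> = m + n + \<theta> / z * (m * x + n * y - (m + n) * z)"
    using z by (simp add: field_simps)
  also have "(m + n) * z = m * x + n * y"
    using assms by (simp add: z_def)
  finally show ?thesis by simp
qed

section \<open>Moments of a finite-energy density\<close>

lemma inner_matrix_eq_trace_tensor: "x \<bullet> (M *v y) = trace (M ** tensor y x)"
  by (simp add: trace_def tensor_def matrix_matrix_mult_def matrix_vector_mult_def inner_vec_def
      sum_distrib_left mult_ac)

lemma bounded_bilinear_tensor: "bounded_bilinear tensor"
  unfolding bilinear_conv_bounded_bilinear[symmetric] bilinear_def
  by (auto intro!: linearI simp: tensor_def vec_eq_iff algebra_simps)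

locale finite_energy_density =
  fixes \<delta> :: real and f :: "(real^3) \<times> real \<Rightarrow> real"
  assumes \<delta>: "\<delta> > 0"
    and meas: "f \<in> borel_measurable phase"
    and nonneg: "\<And>v I. I > 0 \<Longrightarrow> f (v, I) \<ge> 0"
    and mass: "mass_density f > 0"
    and energy: "integrable phase (\<lambda>(v, I). (1 + (norm v)\<^sup>2 + I powr (2 / \<delta>)) * f (v, I))"
begin

abbreviation "\<rho> \<equiv> mass_density f"
abbreviation "U \<equiv> bulk_velocity f"
abbreviation "w \<equiv> (\<lambda>z::(real^3) \<times> real. fst z - U)"

text \<open>
  The energy condition makes every moment of at most quadratic growth in \<open>v\<close> and linear growth in
  \<open>I\<^bsup>2/\<delta>\<^esup>\<close> finite; the integrability facts about \<open>f\<close> below all rest on this.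
\<close>
lemma integrable_moment:
  fixes h :: "(real^3) \<times> real \<Rightarrow> 'b::{banach, second_countable_topology}"
  assumes h: "h \<in> borel_measurable borel"
    and le: "\<And>v I. norm (h (v, I)) \<le> C * (1 + (norm v)\<^sup>2 + I powr (2 / \<delta>))"
  shows "integrable phase (\<lambda>z. f z *\<^sub>R h z)"
proof (rule Bochner_Integration.integrable_bound)
  show "integrable phase (\<lambda>z. C * (case z of (v, I) \<Rightarrow> (1 + (norm v)\<^sup>2 + I powr (2 / \<delta>)) * f (v, I)))"
    by (intro integrable_mult_right energy)
  show "(\<lambda>z. f z *\<^sub>R h z) \<in> borel_measurable phase"
    using meas borel_measurable_phase[OF h] by measurable
  show "AE z in phase. norm (f z *\<^sub>R h z)
      \<le> norm (C * (case z of (v, I) \<Rightarrow> (1 + (norm v)\<^sup>2 + I powr (2 / \<delta>)) * f (v, I)))"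
  proof (rule AE_I2)
    fix z :: "(real^3) \<times> real"
    obtain v I where z: "z = (v, I)" by (cases z)
    have "norm (f z *\<^sub>R h z) \<le> \<bar>f z\<bar> * (C * (1 + (norm v)\<^sup>2 + I powr (2 / \<delta>)))"
      using le[of v I] by (simp add: z mult_left_mono)
    also have "\<dots> \<le> \<bar>f z * (C * (1 + (norm v)\<^sup>2 + I powr (2 / \<delta>)))\<bar>"
      by (subst abs_mult[of "f z"]) (intro mult_left_mono abs_ge_self abs_ge_zero)
    finally show "norm (f z *\<^sub>R h z)
      \<le> norm (C * (case z of (v, I) \<Rightarrow> (1 + (norm v)\<^sup>2 + I powr (2 / \<delta>)) * f (v, I)))"
      by (simp add: z mult_ac)
  qed
qed

lemma moment_pos:
  fixes h :: "(real^3) \<times> real \<Rightarrow> real"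
  assumes int: "integrable phase (\<lambda>z. h z * f z)" and pos: "AE z in phase. h z > 0"
  shows "(\<integral>z. h z * f z \<partial>phase) > 0"
proof -
  have f0: "AE z in phase. 0 \<le> f z"
    by (rule AE_I2) (auto simp: space_restrict_space nonneg)
  have hf0: "AE z in phase. 0 \<le> h z * f z"
    using pos f0 by eventually_elim simp
  have "(\<integral>z. h z * f z \<partial>phase) \<noteq> 0"
  proof
    assume "(\<integral>z. h z * f z \<partial>phase) = 0"
    then have "AE z in phase. h z * f z = 0"
      using integral_nonneg_eq_0_iff_AE[OF int hf0] by simp
    then have "AE z in phase. f z = 0"
      using pos by eventually_elim auto
    then have "(\<integral>z. f z \<partial>phase) = 0"
      using integral_eq_zero_AE by blast
    then show False using mass by (simp add: mass_density_def)
  qed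
  then show ?thesis
    using integral_nonneg_AE[OF hf0] by linarith
qed

lemma integrable_stress: "integrable phase (\<lambda>z. f z *\<^sub>R tensor (w z) (w z))"
proof -
  obtain K where K: "K > 0" "\<And>a b. norm (tensor a b) \<le> norm a * norm b * K"
    using bounded_bilinear.pos_bounded[OF bounded_bilinear_tensor] by blast
  define C where "C = 2 * K * (1 + (norm U)\<^sup>2)"
  show ?thesis
  proof (rule integrable_moment[where C = C])
    have "continuous_on UNIV (\<lambda>z::(real^3) \<times> real. tensor (w z) (w z))"
      by (intro bounded_bilinear.continuous_on[OF bounded_bilinear_tensor] continuous_intros)
    then show "(\<lambda>z. tensor (w z) (w z)) \<in> borel_measurable borel"
      by (rule borel_measurable_continuous_onI)
    fix v :: "real^3" and I :: real
    have "norm (v - U) ^ 2 \<le> (norm v + norm U)\<^sup>2"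
      by (intro power_mono norm_triangle_ineq4) simp
    also have "\<dots> \<le> 2 * (norm v)\<^sup>2 + 2 * (norm U)\<^sup>2"
      using sum_squares_bound[of "norm v" "norm U"] by (simp add: power2_sum)
    also have "\<dots> \<le> 2 * (1 + (norm U)\<^sup>2) * (1 + (norm v)\<^sup>2)"
      by (simp add: algebra_simps)
    also have "\<dots> \<le> 2 * (1 + (norm U)\<^sup>2) * (1 + (norm v)\<^sup>2 + I powr (2 / \<delta>))"
      by (intro mult_left_mono) auto
    finally have "K * norm (v - U) ^ 2 \<le> K * (2 * (1 + (norm U)\<^sup>2) * (1 + (norm v)\<^sup>2 + I powr (2 / \<delta>)))"
      using K(1) by (intro mult_left_mono) auto
    then show "norm (tensor (w (v, I)) (w (v, I))) \<le> C * (1 + (norm v)\<^sup>2 + I powr (2 / \<delta>))"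
      using K(2)[of "v - U" "v - U"] by (simp add: C_def power2_eq_square mult_ac)
  qed
qed

text \<open>
  Linear functionals commute with the integral defining \<open>\<Theta>\<close>. The trace, the entries and the
  quadratic form of \<open>\<Theta>\<close>, and the mean of any quadratic form in \<open>v - U\<close>, are all read off from this.
\<close>
lemma stress_moment:
  fixes L :: "real^3^3 \<Rightarrow> real"
  assumes "linear L"
  shows "integrable phase (\<lambda>z. L (tensor (w z) (w z)) * f z)"
    and "(\<integral>z. L (tensor (w z) (w z)) * f z \<partial>phase) = \<rho> * L (stress_tensor f)"
proof -
  have L: "bounded_linear L" using assms by (simp add: linear_linear)
  have eq: "(\<lambda>z. L (tensor (w z) (w z)) * f z) = (\<lambda>z. L (f z *\<^sub>R tensor (w z) (w z)))"
    using assms by (simp add: linear_scale mult.commute)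
  show "integrable phase (\<lambda>z. L (tensor (w z) (w z)) * f z)"
    unfolding eq by (rule integrable_bounded_linear[OF L integrable_stress])
  have "(\<integral>z. L (tensor (w z) (w z)) * f z \<partial>phase) = L (\<integral>z. f z *\<^sub>R tensor (w z) (w z) \<partial>phase)"
    unfolding eq by (rule integral_bounded_linear[OF L integrable_stress])
  also have "(\<integral>z. f z *\<^sub>R tensor (w z) (w z) \<partial>phase) = \<rho> *\<^sub>R stress_tensor f"
    using mass by (simp add: stress_tensor_def case_prod_unfold)
  finally show "(\<integral>z. L (tensor (w z) (w z)) * f z \<partial>phase) = \<rho> * L (stress_tensor f)"
    using assms by (simp add: linear_scale)
qed

lemma quadratic_moment:
  fixes M :: "real^3^3"
  shows "integrable phase (\<lambda>z. (w z \<bullet> (M *v w z)) * f z)"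
    and "(\<integral>z. (w z \<bullet> (M *v w z)) * f z \<partial>phase) = \<rho> * trace (M ** stress_tensor f)"
proof -
  have "linear (\<lambda>X. trace (M ** X))"
    by (intro linearI) (simp_all add: matrix_add_ldistrib trace_add matrix_mult_scaleR_right trace_scaleR)
  from stress_moment[OF this]
  show "integrable phase (\<lambda>z. (w z \<bullet> (M *v w z)) * f z)"
    and "(\<integral>z. (w z \<bullet> (M *v w z)) * f z \<partial>phase) = \<rho> * trace (M ** stress_tensor f)"
    by (simp_all add: inner_matrix_eq_trace_tensor)
qed

lemma stress_tensor_symmetric: "transpose (stress_tensor f) = stress_tensor f"
proof -
  have "stress_tensor f $ j $ i = stress_tensor f $ i $ j" for i j
  proof -
    have l: "linear (\<lambda>X::real^3^3. X $ i $ j)" for i j by (intro linearI) auto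
    have "\<rho> * stress_tensor f $ j $ i = \<rho> * stress_tensor f $ i $ j"
      unfolding stress_moment(2)[OF l, symmetric] by (simp add: tensor_def mult.commute)
    then show ?thesis using mass by simp
  qed
  then show ?thesis by (simp add: vec_eq_iff transpose_def)
qed

lemma stress_tensor_nonneg: "x \<bullet> (stress_tensor f *v x) \<ge> 0"
proof -
  have l: "linear (\<lambda>X. x \<bullet> (X *v x))"
    by (intro linearI) (simp_all add: matrix_vector_mult_add_rdistrib inner_add_right
        scaleR_matrix_vector_assoc[symmetric])
  have "x \<bullet> (tensor a a *v x) = (a \<bullet> x)\<^sup>2" for a
  proof -
    have "tensor a a *v x = (a \<bullet> x) *\<^sub>R a"
      by (simp add: vec_eq_iff tensor_def matrix_vector_mult_def inner_vec_def sum_distrib_left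
          sum_distrib_right mult_ac)
    then show ?thesis by (simp add: power2_eq_square inner_commute)
  qed
  then have "0 \<le> \<rho> * (x \<bullet> (stress_tensor f *v x))"
    unfolding stress_moment(2)[OF l, symmetric]
    by (intro integral_nonneg_AE AE_I2) (auto simp: space_restrict_space nonneg)
  then show ?thesis using mass by (simp add: zero_le_mult_iff)
qed

lemma T_tr_pos: "T_tr f > 0"
  and trace_stress_tensor: "trace (stress_tensor f) = 3 * T_tr f"
proof -
  have E: "E_tr f = (\<integral>z. 1 / 2 * ((w z \<bullet> (mat 1 *v w z)) * f z) \<partial>phase)"
    by (simp add: E_tr_def case_prod_unfold power2_norm_eq_inner)
  also have "\<dots> = 1 / 2 * (\<rho> * trace (stress_tensor f))"
    unfolding integral_mult_right_zero quadratic_moment by simp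
  finally show "trace (stress_tensor f) = 3 * T_tr f"
    using mass by (simp add: T_tr_def)
  have "AE z in phase. w z \<bullet> (mat 1 *v w z) > 0"
    using AE_phase_velocity_neq[of U] by eventually_elim simp
  from moment_pos[OF quadratic_moment(1) this]
  have "E_tr f > 0" unfolding E by simp
  then show "T_tr f > 0" using mass by (simp add: T_tr_def)
qed

lemma integrable_internal_energy: "integrable phase (\<lambda>z. snd z powr (2 / \<delta>) * f z)"
proof -
  have "integrable phase (\<lambda>z. f z *\<^sub>R (snd z powr (2 / \<delta>)))"
    by (rule integrable_moment[where C = 1]) (auto simp: borel_measurable_snd_powr)
  then show ?thesis by (simp add: mult.commute)
qed

lemma T_int_pos: "T_int \<delta> f > 0"
proof -
  have "AE z in phase. snd z powr (2 / \<delta>) > 0"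
    by (rule AE_I2) (auto simp: space_restrict_space)
  from moment_pos[OF integrable_internal_energy this]
  show ?thesis using mass \<delta> by (simp add: T_int_def E_int_def case_prod_unfold)
qed

text \<open>Energies add, so the total temperature is the mean weighted by degrees of freedom.\<close>
lemma T_total_eq: "T_total \<delta> f = (3 * T_tr f + \<delta> * T_int \<delta> f) / (3 + \<delta>)"
proof -
  have "T_total \<delta> f = (3 / 2 * \<rho> * T_tr f + \<delta> / 2 * \<rho> * T_int \<delta> f) / ((3 + \<delta>) / 2 * \<rho>)"
    unfolding T_total_def E_total_def
    using temperature_relations(2,3)[OF \<delta>, of f] mass by simp
  also have "\<dots> = (3 * T_tr f + \<delta> * T_int \<delta> f) / (3 + \<delta>)"
    using mass \<delta> by (simp add: divide_simps) (simp add: algebra_simps)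
  finally show ?thesis .
qed

lemma T_total_pos: "T_total \<delta> f > 0"
  unfolding T_total_eq using T_tr_pos T_int_pos \<delta> by (simp add: add_pos_pos)

context
  fixes \<nu> \<theta> :: real
  assumes \<theta>: "0 \<le> \<theta>" "\<theta> \<le> 1" and \<nu>: "0 \<le> \<nu>" "\<nu> < 1"
begin

abbreviation "T \<equiv> temperature_tensor \<delta> \<nu> \<theta> f"
abbreviation "\<tau> \<equiv> relaxation_temperature \<delta> \<theta> f"

lemma convex_combination_pos:
  assumes "x > 0" "y > 0"
  shows "(1 - \<theta>) * x + \<theta> * y > 0"
  using assms \<theta> by (cases "\<theta> = 0") (auto intro!: add_nonneg_pos)

lemma relaxation_temperature_pos: "\<tau> > 0"
  unfolding relaxation_temperature_def by (intro convex_combination_pos T_int_pos T_total_pos)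

lemma temperature_tensor_eq:
  "T = ((1 - \<theta>) * ((1 - \<nu>) * T_tr f) + \<theta> * T_total \<delta> f) *\<^sub>R mat 1
       + ((1 - \<theta>) * \<nu>) *\<^sub>R stress_tensor f"
  by (simp add: temperature_tensor_def algebra_simps)

lemma isotropic_part_pos: "(1 - \<theta>) * ((1 - \<nu>) * T_tr f) + \<theta> * T_total \<delta> f > 0"
  using \<nu> T_tr_pos T_total_pos by (intro convex_combination_pos) auto

text \<open>
  The isotropic part is positive even when \<open>\<Theta>\<close> is degenerate, which is where \<open>\<nu> < 1\<close> enters: for
  \<open>\<theta> = 0\<close> it is \<open>(1 - \<nu>) T\<^sub>t\<^sub>r\<close>.
\<close>
lemma temperature_tensor_pos_def: "pos_def T"
  unfolding pos_def_def
proof (intro conjI allI impI)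
  show "transpose T = T"
    using stress_tensor_symmetric
    by (simp add: temperature_tensor_eq vec_eq_iff transpose_def mat_def)
  fix x :: "real^3"
  assume "x \<noteq> 0"
  then show "x \<bullet> (T *v x) > 0"
    unfolding temperature_tensor_eq
    using isotropic_part_pos stress_tensor_nonneg[of x] \<theta> \<nu>
    by (simp add: matrix_vector_mult_add_rdistrib scaleR_matrix_vector_assoc[symmetric]
        inner_add_right add_pos_nonneg)
qed

lemma exponent_moment:
  "integrable phase (\<lambda>(v, I). f (v, I) * gaussian_exponent \<delta> \<nu> \<theta> f v I)"
  "(\<integral>(v, I). f (v, I) * gaussian_exponent \<delta> \<nu> \<theta> f v I \<partial>phase)
     = \<rho> / 2 * (trace (matrix_inv T ** stress_tensor f) + \<delta> * T_int \<delta> f / \<tau>)"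
proof -
  have eq: "(\<lambda>(v, I). f (v, I) * gaussian_exponent \<delta> \<nu> \<theta> f v I)
    = (\<lambda>z. 1 / 2 * ((w z \<bullet> (matrix_inv T *v w z)) * f z) + 1 / \<tau> * (snd z powr (2 / \<delta>) * f z))"
    by (auto simp: gaussian_exponent_def algebra_simps)
  note int = integrable_mult_right[OF quadratic_moment(1)] integrable_mult_right[OF integrable_internal_energy]
  show "integrable phase (\<lambda>(v, I). f (v, I) * gaussian_exponent \<delta> \<nu> \<theta> f v I)"
    unfolding eq by (intro Bochner_Integration.integrable_add int)
  have e: "(\<integral>z. snd z powr (2 / \<delta>) * f z \<partial>phase) = \<delta> / 2 * \<rho> * T_int \<delta> f"
    using temperature_relations(3)[OF \<delta>, of f] mass by (simp add: E_int_def case_prod_unfold)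
  show "(\<integral>(v, I). f (v, I) * gaussian_exponent \<delta> \<nu> \<theta> f v I \<partial>phase)
     = \<rho> / 2 * (trace (matrix_inv T ** stress_tensor f) + \<delta> * T_int \<delta> f / \<tau>)"
    unfolding eq Bochner_Integration.integral_add[OF int] integral_mult_right_zero quadratic_moment e
    by (simp add: algebra_simps)
qed

text \<open>
  Jensen's inequality twice: over the eigenvalues of \<open>\<Theta>\<close>, then over the translational and internal
  temperatures.
\<close>
lemma exponent_moment_le:
  "(\<integral>(v, I). f (v, I) * gaussian_exponent \<delta> \<nu> \<theta> f v I \<partial>phase) \<le> \<rho> * ((3 + \<delta>) / 2)"
proof -
  let ?x = "T_tr f" and ?y = "T_int \<delta> f" and ?z = "T_total \<delta> f"
  have "trace (matrix_inv T ** stress_tensor f)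
      \<le> CARD(3) * ?x / ((1 - \<theta>) * ((1 - \<nu>) * ?x) + \<theta> * ?z + (1 - \<theta>) * \<nu> * ?x)"
    unfolding temperature_tensor_eq
  proof (rule trace_matrix_inv_mult_le)
  qed (use temperature_tensor_pos_def isotropic_part_pos \<theta> \<nu> T_tr_pos trace_stress_tensor
       in \<open>auto simp: temperature_tensor_eq\<close>)
  also have "(1 - \<theta>) * ((1 - \<nu>) * ?x) + \<theta> * ?z + (1 - \<theta>) * \<nu> * ?x = (1 - \<theta>) * ?x + \<theta> * ?z"
    by (simp add: algebra_simps)
  finally have "trace (matrix_inv T ** stress_tensor f) + \<delta> * ?y / \<tau>
      \<le> 3 * ?x / ((1 - \<theta>) * ?x + \<theta> * ?z) + \<delta> * ?y / ((1 - \<theta>) * ?y + \<theta> * ?z)"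
    by (simp add: relaxation_temperature_def)
  also have "\<dots> \<le> 3 + \<delta>"
    unfolding T_total_eq using T_tr_pos T_int_pos \<delta> \<theta> by (intro relaxed_ratio_sum_le) auto
  finally have "\<rho> / 2 * (trace (matrix_inv T ** stress_tensor f) + \<delta> * ?y / \<tau>) \<le> \<rho> / 2 * (3 + \<delta>)"
    using mass by (intro mult_left_mono) auto
  then show ?thesis unfolding exponent_moment by simp
qed

text \<open>
  Equipartition: each of the \<open>3 + \<delta>\<close> degrees of freedom contributes \<open>\<rho>/2\<close>. The constant \<open>Z\<close> below
  is the integral of \<open>exp (- g)\<close>, and \<open>\<rho> / Z\<close> is the prefactor of the Gaussian.
\<close>
lemma gaussian_exponent_mean:
  "has_bochner_integral phase
     (\<lambda>(v, I). polyatomic_gaussian \<delta> \<nu> \<theta> f v I * gaussian_exponent \<delta> \<nu> \<theta> f v I)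
     (\<rho> * ((3 + \<delta>) / 2))"
proof -
  define g where "g = (\<lambda>z. gaussian_exponent \<delta> \<nu> \<theta> f (fst z) (snd z))"
  define Z where "Z = sqrt (det ((2 * pi) *\<^sub>R T)) * \<tau> powr (\<delta> / 2) / normalizer \<delta>"
  have P: "pos_def (matrix_inv T)"
    by (rule pos_def_matrix_inv[OF temperature_tensor_pos_def])
  have "has_bochner_integral phase (\<lambda>z. g z * exp (- g z)) ((3 + \<delta>) / 2 * Z)"
  proof (rule exponent_mean_of_homogeneous_partition)
    have "continuous_on UNIV (\<lambda>z::(real^3) \<times> real. 1 / 2 * (w z \<bullet> (matrix_inv T *v w z)))"
      by (intro continuous_intros continuous_on_compose2[OF continuous_on_quadratic_form[of UNIV]]) auto
    then have "(\<lambda>z::(real^3) \<times> real. 1 / 2 * (w z \<bullet> (matrix_inv T *v w z))) \<in> borel_measurable borel"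
      by (rule borel_measurable_continuous_onI)
    then show "g \<in> borel_measurable phase"
      unfolding g_def gaussian_exponent_def by (intro borel_measurable_phase borel_measurable_add borel_measurable_divide borel_measurable_snd_powr) auto
    show "0 \<le> g z" if "z \<in> space phase" for z
    proof -
      have "0 \<le> w z \<bullet> (matrix_inv T *v w z)"
        using P by (cases "w z = 0") (auto simp: pos_def_def less_imp_le)
      then show ?thesis
        using relaxation_temperature_pos by (simp add: g_def gaussian_exponent_def)
    qed
    show "has_bochner_integral phase (\<lambda>z. exp (- (s * g z))) (s powr (- ((3 + \<delta>) / 2)) * Z)" if "s > 0" for s
      using maxwellian_partition[OF temperature_tensor_pos_def \<delta> relaxation_temperature_pos that, of U]
      by (simp add: g_def gaussian_exponent_def Z_def case_prod_unfold)
  qed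
  then have "has_bochner_integral phase (\<lambda>z. \<rho> / Z * (g z * exp (- g z))) (\<rho> / Z * ((3 + \<delta>) / 2 * Z))"
    by (rule has_bochner_integral_mult_right)
  moreover have "Z > 0"
  proof -
    have "det ((2 * pi) *\<^sub>R T) > 0"
      by (intro pos_def_det pos_def_scaleR temperature_tensor_pos_def) simp
    then show ?thesis
      using relaxation_temperature_pos internal_energy_normalizer(1)[OF \<delta>] by (simp add: Z_def)
  qed
  moreover have "(\<lambda>(v, I). polyatomic_gaussian \<delta> \<nu> \<theta> f v I * gaussian_exponent \<delta> \<nu> \<theta> f v I)
      = (\<lambda>z. \<rho> / Z * (g z * exp (- g z)))"
    by (auto simp: polyatomic_gaussian_def g_def Z_def)
  ultimately show ?thesis by simp
qed

lemma remainder_term_nonneg: "remainder_term \<delta> \<nu> \<theta> f \<ge> 0"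
proof -
  let ?M = "\<lambda>z. case z of (v, I) \<Rightarrow> polyatomic_gaussian \<delta> \<nu> \<theta> f v I * gaussian_exponent \<delta> \<nu> \<theta> f v I"
  let ?f = "\<lambda>z. case z of (v, I) \<Rightarrow> f (v, I) * gaussian_exponent \<delta> \<nu> \<theta> f v I"
  have M: "integrable phase ?M" "integral\<^sup>L phase ?M = \<rho> * ((3 + \<delta>) / 2)"
    using gaussian_exponent_mean by (simp_all only: has_bochner_integral_iff)
  have "remainder_term \<delta> \<nu> \<theta> f = (\<integral>z. ?M z - ?f z \<partial>phase)"
    unfolding remainder_term_def by (rule arg_cong[of _ _ "integral\<^sup>L phase"]) (auto simp: left_diff_distrib)
  also have "\<dots> = \<rho> * ((3 + \<delta>) / 2) - (\<integral>z. ?f z \<partial>phase)"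
    using Bochner_Integration.integral_diff[OF M(1) exponent_moment(1)] M(2) by (simp only:)
  finally show ?thesis using exponent_moment_le by simp
qed

end

end

theorem theorem1p1:
  fixes \<delta> \<nu> \<theta> :: real and f :: "(real^3) \<times> real \<Rightarrow> real"
  assumes "\<delta> > 0" and "0 \<le> \<theta>" and "\<theta> \<le> 1" and "0 \<le> \<nu>" and "\<nu> < 1"
    and "f \<in> borel_measurable phase"
    and "\<And>v I. I > 0 \<Longrightarrow> f (v, I) \<ge> 0"
    and "(\<integral>(v, I). f (v, I) \<partial>phase) > 0"
    and "integrable phase (\<lambda>(v, I). (1 + (norm v)\<^sup>2 + I powr (2 / \<delta>)) * f (v, I))"
  shows "remainder_term \<delta> \<nu> \<theta> f \<ge> 0"
proof -
  interpret finite_energy_density \<delta> f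
    using assms by unfold_locales (auto simp: mass_density_def)
  show ?thesis using assms by (intro remainder_term_nonneg)
qed

end
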